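(* For integers $n\ge 0$, $j\ge0$ let $$c(n,j)=q^{2\binom{n-j}{2}}\frac{(-q^{j};q)_{n-j}}{(-q;q)_{n-j}}\begin{bmatrix} j\\ n-j\end{bmatrix}\quad\text{if } n\ge j,\qquad c(n,j)=0\quad\text{if } n<j.$$ Then for every positive integer $k$ and every nonnegative integer $n$, $$\det\left(c(i+k+1,j+k)\right)_{i,j=0}^{n-1}=\frac{[k]}{[2n+k]}\begin{bmatrix}2n+k\\ n\end{bmatrix}\frac{(-q^{n+1};q)_{k-1}}{(-q;q)_{k-1}}.$$
   Context: $q$ is an indeterminate. $(a;q)_r=(1-a)(1-aq)\cdots(1-aq^{r-1})$ for integers $r\ge0$; $[a]=\frac{1-q^a}{1-q}$; for integers $a\ge0$, $b$, $\begin{bmatrix}a\\ b\end{bmatrix}=\frac{(q;q)_a}{(q;q)_b(q;q)_{a-b}}$ if $0\le b\le a$ and $0$ otherwise. $\binom{a}{2}=a(a-1)/2$. Determinants of $0\times 0$ matrices equal $1$. *)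

theory Defs
  imports
    Jordan_Normal_Form.Determinant
    "HOL-Computational_Algebra.Fraction_Field"
    "HOL-Computational_Algebra.Polynomial"
begin

text \<open>The indeterminate \<open>q\<close>, as an element of the field of rational functions \<open>\<rat>(q)\<close>.\<close>

definition qvar :: "rat poly fract" where
  "qvar = Fract [:0, 1:] 1"

definition qpoch :: "'a::field \<Rightarrow> 'a \<Rightarrow> nat \<Rightarrow> 'a" where
  "qpoch a q r = (\<Prod>i<r. 1 - a * q ^ i)"

definition qint :: "'a::field \<Rightarrow> nat \<Rightarrow> 'a" where
  "qint q a = (1 - q ^ a) / (1 - q)"

definition qbinom :: "'a::field \<Rightarrow> nat \<Rightarrow> int \<Rightarrow> 'a" where
  "qbinom q a b =
     (if 0 \<le> b \<and> b \<le> int a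
      then qpoch q q a / (qpoch q q (nat b) * qpoch q q (a - nat b))
      else 0)"

definition c :: "'a::field \<Rightarrow> nat \<Rightarrow> nat \<Rightarrow> 'a" where
  "c q n j =
     (if n \<ge> j
      then q ^ (2 * ((n - j) choose 2)) *
           (qpoch (- (q ^ j)) q (n - j) / qpoch (- q) q (n - j)) *
           qbinom q j (int n - int j)
      else 0)"

end

theory Submission imports Defs begin

text \<open>
  Let \<open>C\<close> be the unitriangular matrix with entries \<open>c (i + k) (j + k)\<close>. Up to the sign \<open>(- 1) ^ n\<close>
  the determinant is the entry \<open>(n, 0)\<close> of the inverse of \<open>C\<close>, so it suffices to show that \<open>C\<close>
  maps the vector of the claimed values, with alternating signs, to the first unit vector. After
  cancelling \<open>q\<close>-Pochhammer symbols and setting \<open>p = q\<^sup>2\<close>, each of the remaining sums becomes the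
  \<open>n\<close>-th \<open>p\<close>-difference, on the nodes \<open>1, p, \<dots>, p ^ n\<close>, of a polynomial of degree at most
  \<open>n - 1\<close>, hence vanishes.
\<close>

section \<open>q-Pochhammer symbols away from roots of unity\<close>

lemma qpoch_0 [simp]: "qpoch a q 0 = 1"
  by (simp add: qpoch_def)

lemma qpoch_Suc: "qpoch a q (Suc r) = qpoch a q r * (1 - a * q ^ r)"
  by (simp add: qpoch_def)

lemma qpoch_add: "qpoch a q (r + s) = qpoch a q r * qpoch (a * q ^ r) q s"
  by (induction s) (simp_all add: qpoch_Suc power_add mult.assoc)

text \<open>Factorwise 1 - q^(2i) = (1 - q^i)(1 + q^i). This links base \<open>q\<close> to base
  \<open>p = q ^ 2\<close>.\<close>

lemma qpoch_square: "qpoch (q ^ 2) (q ^ 2) r = qpoch q q r * qpoch (- q) q r"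
  by (induction r)
    (simp_all add: qpoch_Suc algebra_simps power2_eq_square flip: power_mult_distrib)

lemma qpoch_self_nonzero:
  fixes q :: "'a::field"
  assumes "\<And>m. m > 0 \<Longrightarrow> q ^ m \<noteq> 1"
  shows "qpoch q q r \<noteq> 0"
  using assms[of "Suc _"] by (simp add: qpoch_def)

lemma power_square_neq_1:
  fixes q :: "'a::field"
  assumes "\<And>m. m > 0 \<Longrightarrow> q ^ m \<noteq> 1" and "m > 0"
  shows "(q ^ 2) ^ m \<noteq> 1"
  using assms(1)[of "2 * m"] assms(2) by (simp add: power_mult)

lemma qpoch_minus_self_nonzero:
  fixes q :: "'a::field"
  assumes "\<And>m. m > 0 \<Longrightarrow> q ^ m \<noteq> 1"
  shows "qpoch (- q) q r \<noteq> 0"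
  using qpoch_self_nonzero[of "q ^ 2" r] power_square_neq_1[OF assms]
  by (simp add: qpoch_square)

lemma qbinom_add:
  "qbinom q (b + r) (int b) = qpoch q q (b + r) / (qpoch q q b * qpoch q q r)"
  by (simp add: qbinom_def)

section \<open>Vanishing of q-differences in low degree\<close>

text \<open>For distinct nonzero nodes 1, p, ..., p^n this is \<open>p ^ (n choose 2)\<close> times
  the coefficient of f(p^m) in the divided difference of f.\<close>

definition qdiff_weight :: "'a::field \<Rightarrow> nat \<Rightarrow> nat \<Rightarrow> 'a" where
  "qdiff_weight p n m = (- 1) ^ m * p ^ ((n - m) choose 2) / (qpoch p p m * qpoch p p (n - m))"

text \<open>As in the q-Pascal rule, 1 - p^(n+1) = (1 - p^m) + p^m (1 - p^(n+1-m)). Each part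
  cancels the last factor of one of the two symbols in the denominator of the weight.\<close>

lemma qdiff_monomial_Suc:
  fixes p :: "'a::field"
  assumes p: "\<And>m. m > 0 \<Longrightarrow> p ^ m \<noteq> 1"
  shows "(1 - p ^ Suc n) * (\<Sum>m\<le>Suc n. qdiff_weight p (Suc n) m * p ^ (m * s)) =
    (p ^ n - p ^ s) * (\<Sum>m\<le>n. qdiff_weight p n m * p ^ (m * s))"
proof -
  note nz = qpoch_self_nonzero[OF p]
  have p1: "1 - p ^ Suc m \<noteq> 0" for m
    using p[of "Suc m"] by simp
  have lower: "(1 - p ^ Suc m) * (qdiff_weight p (Suc n) (Suc m) * p ^ (Suc m * s)) =
      - (p ^ s) * (qdiff_weight p n m * p ^ (m * s))" for m
    using nz[of m] nz[of "n - m"] p1[of m]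
    by (simp add: qdiff_weight_def qpoch_Suc power_add divide_simps)
  have upper: "p ^ m * (1 - p ^ (Suc n - m)) * (qdiff_weight p (Suc n) m * p ^ (m * s)) =
      p ^ n * (qdiff_weight p n m * p ^ (m * s))" if "m \<le> n" for m
  proof -
    obtain r where n: "n = m + r"
      using \<open>m \<le> n\<close> le_Suc_ex by blast
    have "Suc r choose 2 = (r choose 2) + r"
      by (simp add: numeral_2_eq_2)
    then show ?thesis
      using nz[of m] nz[of r] p1[of r]
      by (simp add: n Suc_diff_le qdiff_weight_def qpoch_Suc power_add divide_simps)
  qed
  have split: "1 - p ^ Suc n = (1 - p ^ m) + p ^ m * (1 - p ^ (Suc n - m))" if "m \<le> Suc n" for m
    using that by (simp add: algebra_simps flip: power_add power_Suc)
  have "(1 - p ^ Suc n) * (\<Sum>m\<le>Suc n. qdiff_weight p (Suc n) m * p ^ (m * s)) =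
      (\<Sum>m\<le>Suc n. (1 - p ^ m) * (qdiff_weight p (Suc n) m * p ^ (m * s))) +
      (\<Sum>m\<le>Suc n. p ^ m * (1 - p ^ (Suc n - m)) * (qdiff_weight p (Suc n) m * p ^ (m * s)))"
    unfolding sum_distrib_left sum.distrib[symmetric]
    by (intro sum.cong refl, subst split) (auto simp: algebra_simps)
  also have "(\<Sum>m\<le>Suc n. (1 - p ^ m) * (qdiff_weight p (Suc n) m * p ^ (m * s))) =
      - (p ^ s) * (\<Sum>m\<le>n. qdiff_weight p n m * p ^ (m * s))"
    \<comment> \<open>The term \<open>m = 0\<close> has the factor 1 - 1, so the index can be
      shifted.\<close>
    by (subst sum.atMost_Suc_shift) (simp only: lower sum_distrib_left, simp)
  also have "(\<Sum>m\<le>Suc n. p ^ m * (1 - p ^ (Suc n - m)) * (qdiff_weight p (Suc n) m * p ^ (m * s))) =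
      p ^ n * (\<Sum>m\<le>n. qdiff_weight p n m * p ^ (m * s))"
    \<comment> \<open>Here the top term \<open>m = Suc n\<close> vanishes.\<close>
    unfolding sum_distrib_left sum.atMost_Suc
    by (subst sum.cong[OF refl upper]) simp_all
  finally show ?thesis
    by (simp add: algebra_simps)
qed

lemma qdiff_monomial_eq_0:
  fixes p :: "'a::field"
  assumes p: "\<And>m. m > 0 \<Longrightarrow> p ^ m \<noteq> 1"
  shows "s < n \<Longrightarrow> (\<Sum>m\<le>n. qdiff_weight p n m * p ^ (m * s)) = 0"
proof (induction n)
  case (Suc n)
  \<comment> \<open>The first factor vanishes if \<open>s = n\<close>; otherwise the induction
    hypothesis kills the sum.\<close>
  have "(p ^ n - p ^ s) * (\<Sum>m\<le>n. qdiff_weight p n m * p ^ (m * s)) = 0"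
    using Suc by (cases "s = n") auto
  moreover have "1 - p ^ Suc n \<noteq> 0"
    using p[of "Suc n"] by simp
  ultimately show ?case
    using qdiff_monomial_Suc[OF p, of n s] by (metis mult_eq_0_iff)
qed simp

lemma qdiff_poly_eq_0:
  fixes p :: "'a::field"
  assumes p: "\<And>m. m > 0 \<Longrightarrow> p ^ m \<noteq> 1" and "degree f < n"
  shows "(\<Sum>m\<le>n. qdiff_weight p n m * poly f (p ^ m)) = 0"
proof -
  have "(\<Sum>m\<le>n. qdiff_weight p n m * poly f (p ^ m)) =
      (\<Sum>s\<le>degree f. coeff f s * (\<Sum>m\<le>n. qdiff_weight p n m * p ^ (m * s)))"
    unfolding poly_altdef sum_distrib_left
    by (subst sum.swap) (simp add: power_mult algebra_simps)
  also have "\<dots> = 0"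
    using qdiff_monomial_eq_0[OF p] \<open>degree f < n\<close> by simp
  finally show ?thesis .
qed

section \<open>The claimed values against a row of the matrix\<close>

text \<open>As q tends to 1 this becomes, for \<open>k > 0\<close>, the coefficient of x^n in the
  k-th power of the Catalan generating function.\<close>

definition qcat :: "'a::field \<Rightarrow> nat \<Rightarrow> nat \<Rightarrow> 'a" where
  "qcat q k n = qint q k / qint q (2 * n + k) * qbinom q (2 * n + k) (int n) *
    (qpoch (- (q ^ (n + 1))) q (k - 1) / qpoch (- q) q (k - 1))"

lemma qcat_0:
  fixes q :: "'a::field"
  assumes q: "\<And>m. m > 0 \<Longrightarrow> q ^ m \<noteq> 1" and "k > 0"
  shows "qcat q k 0 = 1"
  using qpoch_self_nonzero[OF q] qpoch_minus_self_nonzero[OF q] q[of 1] q[of k] \<open>k > 0\<close>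
  by (simp add: qcat_def qbinom_def qint_def)

text \<open>Encodes the quotient (q;q)_(2m+k-1) / (q;q)_(2m+k-n) as a polynomial in q^(2m). The term
  \<open>q ^ n\<close> in each factor avoids negative exponents and costs an overall
  q^(n(n-1)).\<close>

definition ratio_poly :: "'a::field \<Rightarrow> nat \<Rightarrow> nat \<Rightarrow> 'a poly" where
  "ratio_poly q k n = (\<Prod>i<n - 1. [:q ^ n, - (q ^ (k + 1 + i)):])"

lemma degree_ratio_poly: "degree (ratio_poly q k n) \<le> n - 1"
proof -
  have "degree (ratio_poly q k n) \<le> (\<Sum>i<n - 1. degree [:q ^ n, - (q ^ (k + 1 + i)):])"
    unfolding ratio_poly_def
    by (rule order_trans[OF degree_prod_sum_le]) (simp_all only: o_def finite_lessThan order_refl)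
  also have "\<dots> \<le> (\<Sum>i<n - 1. 1)"
    by (intro sum_mono) simp
  finally show ?thesis by simp
qed

lemma poly_ratio_poly:
  "poly (ratio_poly q k n) ((q ^ 2) ^ m) = (\<Prod>i<n - 1. q ^ n - q ^ (2 * m + k + 1 + i))"
  by (simp add: ratio_poly_def poly_prod power_add algebra_simps flip: power_mult)

lemma poly_ratio_poly_eq_0:
  assumes "2 * m + k < n" "k > 0"
  shows "poly (ratio_poly q k n) ((q ^ 2) ^ m) = 0"
  unfolding poly_ratio_poly
  \<comment> \<open>At this index the factor is q^n - q^n; \<open>k > 0\<close> keeps the index
    below \<open>n - 1\<close>.\<close>
  by (rule prod_zero) (use assms in \<open>auto intro!: bexI[of _ "n - 2 * m - k - 1"] simp flip: power_Suc\<close>)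

lemma poly_ratio_poly_eq:
  assumes "n \<le> 2 * m + k" "n > 0"
  shows "poly (ratio_poly q k n) ((q ^ 2) ^ m) * qpoch q q (2 * m + k - n) =
    q ^ (n * (n - 1)) * qpoch q q (2 * m + k - 1)"
proof -
  have "(\<Prod>i<n - 1. q ^ n - q ^ (2 * m + k + 1 + i)) =
      (\<Prod>i<n - 1. q ^ n * (1 - q * q ^ (2 * m + k - n) * q ^ i))"
    using assms by (intro prod.cong refl) (simp add: algebra_simps flip: power_add power_Suc)
  also have "\<dots> = q ^ (n * (n - 1)) * qpoch (q * q ^ (2 * m + k - n)) q (n - 1)"
    by (simp add: prod.distrib qpoch_def power_mult)
  finally show ?thesis
    using assms qpoch_add[of q q "2 * m + k - n" "n - 1"] by (simp add: poly_ratio_poly)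
qed

text \<open>The symbol (q;q)_(m+k) cancels, and the symbols in -q merge into (-q;q)_(n+k-1), free of
  m, over denominators that complete the weight to base \<open>q ^ 2\<close>. The remaining quotient
  is \<open>ratio_poly\<close>.\<close>

lemma c_times_qcat:
  fixes q :: "'a::field"
  assumes q: "\<And>m. m > 0 \<Longrightarrow> q ^ m \<noteq> 1" and "q \<noteq> 0" and "k > 0" "n > 0" "m \<le> n"
  shows "c q (n + k) (m + k) * ((- 1) ^ m * qcat q k m) =
    (1 - q ^ k) * qpoch (- q) q (n + k - 1) / (qpoch (- q) q (k - 1) * q ^ (n * (n - 1))) *
    (qdiff_weight (q ^ 2) n m * poly (ratio_poly q k n) ((q ^ 2) ^ m))"
proof (cases "2 * m + k < n")
  case True
  \<comment> \<open>The lower index \<open>n - m\<close> of the q-binomial exceeds the upper index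
    \<open>m + k\<close>.\<close>
  then have "c q (n + k) (m + k) = 0"
    by (simp add: c_def qbinom_def)
  with True \<open>k > 0\<close> show ?thesis
    by (simp add: poly_ratio_poly_eq_0)
next
  case False
  note nz = qpoch_self_nonzero[OF q] qpoch_minus_self_nonzero[OF q]
  obtain r where n: "n = m + r"
    using \<open>m \<le> n\<close> le_Suc_ex by blast
  obtain k' where k: "k = Suc k'"
    using \<open>k > 0\<close> gr0_implies_Suc by blast
  obtain t where t: "m + k = r + t"
    using False n le_Suc_ex[of r "m + k"] by auto
  have c: "c q (n + k) (m + k) = q ^ (2 * (r choose 2)) *
      (qpoch (- (q ^ (m + k))) q r / qpoch (- q) q r) *
      (qpoch q q (m + k) / (qpoch q q r * qpoch q q t))"
    using qbinom_add[of q r t] by (simp add: c_def n flip: t)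
  have "qint q k / qint q (2 * m + k) = (1 - q ^ k) / (1 - q ^ (2 * m + k))"
    using q[of 1] by (simp add: qint_def)
  moreover have "qpoch q q (2 * m + k) = qpoch q q (2 * m + k') * (1 - q ^ (2 * m + k))"
    by (simp add: k qpoch_Suc)
  moreover have "1 - q ^ (2 * m + k) \<noteq> 0"
    using q[of "2 * m + k"] k by simp
  ultimately have cat: "qcat q k m = (1 - q ^ k) * qpoch q q (2 * m + k') /
      (qpoch q q m * qpoch q q (m + k)) *
      (qpoch (- (q ^ (m + 1))) q k' / qpoch (- q) q k')"
    using qbinom_add[of q m "m + k"] by (simp add: qcat_def k mult_2 add.assoc)
  \<comment> \<open>The exponents 1, ..., n + k' of the factors 1 + q^e are cut after m and after m
    + k'.\<close>
  have pq: "qpoch (- q) q (n + k') =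
      qpoch (- q) q m * qpoch (- (q ^ (m + 1))) q k' * qpoch (- (q ^ (m + k))) q r"
    using qpoch_add[of "- q" q "m + k'" r] qpoch_add[of "- q" q m k']
    by (simp add: n k ac_simps)
  have "2 * m + k - n = t"
    using t n by simp
  then have f: "poly (ratio_poly q k n) ((q ^ 2) ^ m) =
      q ^ (n * (n - 1)) * qpoch q q (2 * m + k') / qpoch q q t"
    using poly_ratio_poly_eq[of n m k q] False \<open>n > 0\<close> nz
    by (simp add: k eq_divide_eq)
  have w: "qdiff_weight (q ^ 2) n m = (- 1) ^ m * q ^ (2 * (r choose 2)) /
      (qpoch q q m * qpoch (- q) q m * (qpoch q q r * qpoch (- q) q r))"
    by (simp add: qdiff_weight_def n qpoch_square power_mult)
  have kk: "n + k - 1 = n + k'" "k - 1 = k'"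
    using k by simp_all
  show ?thesis
    unfolding c cat f w kk pq using nz \<open>q \<noteq> 0\<close> by (simp add: field_simps)
qed

lemma sum_c_qcat_eq_0:
  fixes q :: "'a::field"
  assumes q: "\<And>m. m > 0 \<Longrightarrow> q ^ m \<noteq> 1" and "q \<noteq> 0" and "k > 0" "n > 0"
  shows "(\<Sum>m\<le>n. c q (n + k) (m + k) * ((- 1) ^ m * qcat q k m)) = 0"
proof -
  have "degree (ratio_poly q k n) < n"
    using degree_ratio_poly[of q k n] \<open>n > 0\<close> by linarith
  then have "(\<Sum>m\<le>n. qdiff_weight (q ^ 2) n m * poly (ratio_poly q k n) ((q ^ 2) ^ m)) = 0"
    using power_square_neq_1[OF q] by (intro qdiff_poly_eq_0)
  then show ?thesis
    using c_times_qcat[OF assms] by (simp flip: sum_distrib_left sum_divide_distrib)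
qed

section \<open>Hessenberg determinants from a recurrence\<close>

text \<open>Replacing the first column by the combination of columns with coefficients
  \<open>v\<close> keeps the determinant, as \<open>v 0 = 1\<close>, and leaves only the last entry
  of that column possibly nonzero.\<close>

lemma det_hessenberg_of_recurrence:
  fixes a :: "nat \<Rightarrow> nat \<Rightarrow> 'a::comm_ring_1"
  assumes diag: "\<And>i. a i i = 1" and upper: "\<And>i j. i < j \<Longrightarrow> a i j = 0"
    and v0: "v 0 = 1" and rec: "\<And>i. i > 0 \<Longrightarrow> (\<Sum>j\<le>i. a i j * v j) = 0"
  shows "det (mat n n (\<lambda>(i, j). a (Suc i) j)) = (- 1) ^ n * v n"
proof (cases n)
  case 0
  then show ?thesis by (simp add: v0)
next
  case (Suc n')
  define A where "A = mat n n (\<lambda>(i, j). a (Suc i) j)"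
  define V where "V = mat n n (\<lambda>(i, j). if j = 0 then v i else if i = j then 1 else 0)"
  define B where "B = mat n n (\<lambda>(i, j). if j = 0 then (if i = n' then - v n else 0) else a (Suc i) j)"
  have A [simp]: "A \<in> carrier_mat n n" and V [simp]: "V \<in> carrier_mat n n"
    and B [simp]: "B \<in> carrier_mat n n"
    by (simp_all add: A_def V_def B_def)
  have "det V = prod_list (diag_mat V)"
    by (rule det_lower_triangular[OF _ V]) (simp add: V_def)
  also have "\<dots> = 1"
    by (auto simp: prod_list_diag_prod V_def v0 intro!: prod.neutral)
  finally have det_V: "det V = 1" .
  have col0: "(\<Sum>j<n. a (Suc i) j * v j) = (if i = n' then - v n else 0)" if "i < n" for i
  proof (cases "i = n'")
    case True
    \<comment> \<open>The last row omits the term \<open>a n n * v n = v n\<close> of its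
      recurrence, hence the entry \<open>- v n\<close>.\<close>
    have "(\<Sum>j\<le>n. a n j * v j) = 0"
      using rec[of n] Suc by simp
    then show ?thesis
      using True Suc diag[of n] by (simp add: add_eq_0_iff2 flip: lessThan_Suc_atMost)
  next
    case False
    have "(\<Sum>j<n. a (Suc i) j * v j) = (\<Sum>j\<le>Suc i. a (Suc i) j * v j)"
      using False that Suc upper by (intro sum.mono_neutral_right) auto
    then show ?thesis
      using rec[of "Suc i"] False by simp
  qed
  have "A * V = B"
  proof (rule eq_matI)
    fix i j assume "i < dim_row B" "j < dim_col B"
    then have ij: "i < n" "j < n" by (simp_all add: B_def)
    have "(A * V) $$ (i, j) = (\<Sum>l<n. a (Suc i) l * (if j = 0 then v l else if l = j then 1 else 0))"
      using ij by (simp add: A_def V_def scalar_prod_def lessThan_atLeast0)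
    also have "\<dots> = B $$ (i, j)"
    proof (cases "j = 0")
      case True
      then show ?thesis
        using ij col0[of i] by (simp add: B_def)
    next
      case False
      then show ?thesis
        using ij by (simp add: B_def if_distrib[of "(*) _"] cong: if_cong)
    qed
    finally show "(A * V) $$ (i, j) = B $$ (i, j)" .
  qed (simp_all add: A_def V_def B_def)
  then have "det A = det B"
    using det_mult[OF A V] det_V by simp
  also have "det B = (\<Sum>i<n. B $$ (i, 0) * cofactor B i 0)"
    by (rule laplace_expansion_column[OF B]) (simp add: Suc)
  also have "\<dots> = (\<Sum>i<n. if i = n' then - v n * cofactor B n' 0 else 0)"
    by (intro sum.cong) (auto simp: B_def)
  also have "\<dots> = - v n * cofactor B n' 0"
    using Suc by simp
  also have "cofactor B n' 0 = (- 1) ^ n'"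
  proof -
    \<comment> \<open>Without the first column, the superdiagonal of ones becomes the diagonal of a
      lower triangular minor.\<close>
    have D: "mat_delete B n' 0 = mat n' n' (\<lambda>(i, j). a (Suc i) (Suc j))"
      by (rule eq_matI) (auto simp: mat_delete_def B_def Suc)
    have "det (mat_delete B n' 0) = prod_list (diag_mat (mat_delete B n' 0))"
      by (rule det_lower_triangular[of n']) (auto simp: D upper)
    also have "\<dots> = 1"
      by (simp add: D prod_list_diag_prod diag)
    finally show ?thesis
      by (simp add: cofactor_def)
  qed
  finally show ?thesis
    by (simp add: A_def Suc)
qed

section \<open>Specialization to the indeterminate\<close>

lemma qvar_power: "qvar ^ m = Fract (monom 1 m) 1"
  by (induction m) (simp_all add: qvar_def One_fract_def monom_Suc)

lemma qvar_nonzero: "qvar \<noteq> 0"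
  by (simp add: qvar_def Zero_fract_def eq_fract)

lemma qvar_power_neq_1: "m > 0 \<Longrightarrow> qvar ^ m \<noteq> 1"
  by (auto simp: qvar_power One_fract_def eq_fract dest: arg_cong[of _ _ degree] simp: degree_monom_eq)

theorem theorem8:
  fixes k n :: nat
  assumes "k > 0"
  shows "det (mat n n (\<lambda>(i, j). c qvar (i + k + 1) (j + k))) =
    qint qvar k / qint qvar (2 * n + k) * qbinom qvar (2 * n + k) (int n) *
    (qpoch (- (qvar ^ (n + 1))) qvar (k - 1) / qpoch (- qvar) qvar (k - 1))"
proof -
  \<comment> \<open>With \<open>v j = (- 1) ^ j * qcat qvar k j\<close>, the sign in
    \<open>v n\<close> cancels the sign of the Hessenberg formula.\<close>
  have "det (mat n n (\<lambda>(i, j). c qvar (Suc i + k) (j + k))) =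
      (- 1) ^ n * ((- 1) ^ n * qcat qvar k n)"
  proof (rule det_hessenberg_of_recurrence)
    show "c qvar (i + k) (i + k) = 1" for i
      using qpoch_self_nonzero[OF qvar_power_neq_1, of "i + k"] by (simp add: c_def qbinom_def numeral_2_eq_2)
    show "c qvar (i + k) (j + k) = 0" if "i < j" for i j
      using that by (simp add: c_def)
    show "(- 1) ^ 0 * qcat qvar k 0 = 1"
      using qcat_0[OF qvar_power_neq_1 assms] by simp
    show "(\<Sum>j\<le>i. c qvar (i + k) (j + k) * ((- 1) ^ j * qcat qvar k j)) = 0" if "i > 0" for i
      by (rule sum_c_qcat_eq_0[OF qvar_power_neq_1 qvar_nonzero assms that])
  qed
  then show ?thesis
    by (simp add: qcat_def flip: mult.assoc power_add mult_2)
qed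

end
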